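(* Let $n$ be a non-negative integer. Then $$\sum_{\lambda\vdash n}\frac{F_\lambda^2}{n!}\,\mathrm{He}_\lambda(x)=x^n,$$ where the sum runs over all partitions $\lambda$ of $n$.
   Context: A partition $\lambda=(\lambda_1\ge\dots\ge\lambda_r>0)$ of $n$ (written $\lambda\vdash n$) has length $r$ and size $|\lambda|=\sum_i\lambda_i=n$; $\varnothing$ is the partition of $0$. $F_\lambda$ is the number of standard Young tableaux of shape $\lambda$ (with $F_\varnothing=1$). Hermite polynomials: $\mathrm{He}_0(x)=1$, $\mathrm{He}_1(x)=x$, $\mathrm{He}_n(x)=x\,\mathrm{He}_{n-1}(x)-(n-1)\,\mathrm{He}_{n-2}(x)$ for $n\ge2$. The degree sequence of $\lambda$ of length $r$ is $n_\lambda=(n_1,\dots,n_r)$ with $n_i=\lambda_i+r-i$, and $\Delta(n_\lambda)=\prod_{1\le i<j\le r}(n_j-n_i)$. The Wronskian is $\mathrm{Wr}[f_1,\dots,f_r]=\det\big(f_j^{(i-1)}\big)_{1\le i,j\le r}$. The Wronskian Hermite polynomial of $\lambda$ is $\mathrm{He}_\lambda=\mathrm{Wr}[\mathrm{He}_{n_1},\dots,\mathrm{He}_{n_r}]/\Delta(n_\lambda)$, with $\mathrm{He}_\varnothing=1$. *)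

theory Defs
  imports
    "HOL-Library.FuncSet"
    "HOL-Computational_Algebra.Polynomial"
    "Jordan_Normal_Form.Determinant"
begin

text \<open>Lists are indexed from \<open>0\<close>: the part \<open>\<lambda>\<^sub>i\<close> of a partition \<open>\<lambda>\<close> is \<open>l ! (i - 1)\<close>.\<close>

definition partitions :: "nat \<Rightarrow> nat list set" where
  "partitions n = {l. sorted_wrt (\<ge>) l \<and> (\<forall>k \<in> set l. 0 < k) \<and> sum_list l = n}"

definition young_diagram :: "nat list \<Rightarrow> (nat \<times> nat) set" where
  "young_diagram l = {(i, j). i < length l \<and> j < l ! i}"

text \<open>A tableau is a function on the cells; \<^const>\<open>extensional\<close> fixes its value outside the
  diagram, so that counting functions counts tableaux.\<close>

definition standard_tableaux :: "nat list \<Rightarrow> (nat \<times> nat \<Rightarrow> nat) set" where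
  "standard_tableaux l = {T \<in> extensional (young_diagram l).
     bij_betw T (young_diagram l) {1..sum_list l} \<and>
     (\<forall>i j j'. (i, j) \<in> young_diagram l \<longrightarrow> (i, j') \<in> young_diagram l \<longrightarrow> j < j' \<longrightarrow>
        T (i, j) < T (i, j')) \<and>
     (\<forall>i i' j. (i, j) \<in> young_diagram l \<longrightarrow> (i', j) \<in> young_diagram l \<longrightarrow> i < i' \<longrightarrow>
        T (i, j) < T (i', j))}"

definition num_SYT :: "nat list \<Rightarrow> nat" where
  "num_SYT l = card (standard_tableaux l)"

fun hermite :: "nat \<Rightarrow> real poly" where
  "hermite 0 = 1"
| "hermite (Suc 0) = [:0, 1:]"
| "hermite (Suc (Suc n)) = [:0, 1:] * hermite (Suc n) - of_nat (Suc n) * hermite n"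

definition degree_seq :: "nat list \<Rightarrow> nat list" where
  "degree_seq l = map (\<lambda>i. l ! i + (length l - Suc i)) [0..<length l]"

text \<open>The degree sequence is strictly decreasing, so the differences must not be taken in
  \<^typ>\<open>nat\<close>.\<close>

definition vandermonde :: "nat list \<Rightarrow> real" where
  "vandermonde ns = (\<Prod>j<length ns. \<Prod>i<j. real (ns ! j) - real (ns ! i))"

definition wronskian :: "real poly list \<Rightarrow> real poly" where
  "wronskian fs = det (mat (length fs) (length fs) (\<lambda>(i, j). (pderiv ^^ i) (fs ! j)))"

definition wronskian_hermite :: "nat list \<Rightarrow> real poly" where
  "wronskian_hermite l =
     smult (1 / vandermonde (degree_seq l)) (wronskian (map hermite (degree_seq l)))"

text \<open>The sum over \<^const>\<open>partitions\<close> and the cardinality in \<^const>\<open>num_SYT\<close> range over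
  finite sets, hence do not take the default value \<open>0\<close>.\<close>

lemma finite_partitions: "finite (partitions n)"
proof (rule finite_subset)
  have len: "length l \<le> sum_list l" if "\<forall>k \<in> set l. 0 < k" for l :: "nat list"
    using that by (induction l) auto
  show "partitions n \<subseteq> {l. set l \<subseteq> {..n} \<and> length l \<le> n}"
    using len by (auto simp: partitions_def intro: member_le_sum_list)
  show "finite {l. set l \<subseteq> {..n} \<and> length l \<le> n}"
    by (rule finite_lists_length_le) simp
qed

lemma finite_young_diagram: "finite (young_diagram l)"
proof -
  have "young_diagram l = (SIGMA i:{..<length l}. {..<l ! i})"
    by (auto simp: young_diagram_def)
  then show ?thesis by simp
qed

lemma finite_standard_tableaux: "finite (standard_tableaux l)"
proof (rule finite_subset)
  show "standard_tableaux l \<subseteq> (\<Pi>\<^sub>E c \<in> young_diagram l. {1..sum_list l})"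
    by (auto simp: standard_tableaux_def PiE_def dest: bij_betw_imp_funcset)
  show "finite (\<Pi>\<^sub>E c \<in> young_diagram l. {1..sum_list l})"
    by (intro finite_PiE finite_young_diagram) simp
qed

text \<open>The conventions for the empty partition hold by definition.\<close>

lemma num_SYT_Nil: "num_SYT [] = 1"
proof -
  have "standard_tableaux [] = {\<lambda>_. undefined}"
    by (auto simp: standard_tableaux_def young_diagram_def bij_betw_def)
  then show ?thesis by (simp add: num_SYT_def)
qed

lemma wronskian_hermite_Nil: "wronskian_hermite [] = 1"
  by (simp add: wronskian_hermite_def degree_seq_def vandermonde_def wronskian_def)

end

theory Submission
  imports Defs
begin

text \<open>
  The scaled polynomials \<open>h\<^sub>m = He\<^sub>m / m!\<close> satisfy \<open>h\<^sub>m' = h\<^sub>m\<^sub>-\<^sub>1\<close>, so up to a sign and the product of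
  the \<open>n\<^sub>j!\<close> the Wronskian is the Jacobi--Trudi determinant \<open>s\<^sub>\<lambda>(h) = det h(\<lambda>\<^sub>j + i - j)\<close>. With the same
  sign and product, the Vandermonde product is \<open>s\<^sub>\<lambda>(e)\<close> for \<open>e\<^sub>m = 1 / m!\<close>, and \<open>F\<^sub>\<lambda> = n! s\<^sub>\<lambda>(e)\<close>
  because both sides satisfy the branching recursion over the removable cells. Hence the summand of
  \<open>\<lambda>\<close> is \<open>F\<^sub>\<lambda> s\<^sub>\<lambda>(h)\<close>. Iterating the Pieri rule \<open>h\<^sub>1 s\<^sub>\<mu> = \<Sum> s\<^sub>\<lambda>\<close>, the sum over all \<open>\<lambda>\<close> obtained by adding a
  cell to \<open>\<mu>\<close>, yields \<open>\<Sum> F\<^sub>\<lambda> s\<^sub>\<lambda>(h) = h\<^sub>1\<^sup>n = x\<^sup>n\<close>.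

  The Pieri rule and the branching recursion for \<open>s\<^sub>\<lambda>(e)\<close> both follow from one observation: replacing
  column \<open>j\<close> of a matrix by column \<open>j\<close> of another one and summing the determinants over \<open>j\<close> gives the
  same result as doing so with rows. For Pieri the second matrix is the first one shifted by a row, so
  that all row replacements but the last create equal rows; for the branching recursion
  \<open>m e\<^sub>m = e\<^sub>m\<^sub>-\<^sub>1\<close> turns lowering an index into scaling rows and columns.
\<close>

section \<open>Jacobi--Trudi determinants\<close>

lemma det_replace_column:
  fixes f g :: "nat \<Rightarrow> nat \<Rightarrow> 'a::comm_ring_1"
  assumes "j < r"
  shows "det (mat r r (\<lambda>(i, k). if k = j then g i k else f i k)) =
    (\<Sum>i<r. g i j * cofactor (mat r r (\<lambda>(i, k). f i k)) i j)"
proof -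
  let ?A = "mat r r (\<lambda>(i, k). if k = j then g i k else f i k)"
  have "det ?A = (\<Sum>i<r. ?A $$ (i, j) * cofactor ?A i j)"
    by (rule laplace_expansion_column) (use assms in auto)
  also have "\<dots> = (\<Sum>i<r. g i j * cofactor (mat r r (\<lambda>(i, k). f i k)) i j)"
  proof (rule sum.cong[OF refl])
    fix i assume "i \<in> {..<r}"
    moreover have "mat_delete ?A i j = mat_delete (mat r r (\<lambda>(i, k). f i k)) i j"
      using assms by (intro eq_matI) (auto simp: mat_delete_def)
    ultimately show "?A $$ (i, j) * cofactor ?A i j
        = g i j * cofactor (mat r r (\<lambda>(i, k). f i k)) i j"
      using assms by (simp add: cofactor_def)
  qed
  finally show ?thesis .
qed

lemma det_replace_row:
  fixes f g :: "nat \<Rightarrow> nat \<Rightarrow> 'a::comm_ring_1"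
  assumes "i < r"
  shows "det (mat r r (\<lambda>(k, j). if k = i then g k j else f k j)) =
    (\<Sum>j<r. g i j * cofactor (mat r r (\<lambda>(k, j). f k j)) i j)"
proof -
  let ?A = "mat r r (\<lambda>(k, j). if k = i then g k j else f k j)"
  have "det ?A = (\<Sum>j<r. ?A $$ (i, j) * cofactor ?A i j)"
    by (rule laplace_expansion_row) (use assms in auto)
  also have "\<dots> = (\<Sum>j<r. g i j * cofactor (mat r r (\<lambda>(k, j). f k j)) i j)"
  proof (rule sum.cong[OF refl])
    fix j assume "j \<in> {..<r}"
    moreover have "mat_delete ?A i j = mat_delete (mat r r (\<lambda>(k, j). f k j)) i j"
      using assms by (intro eq_matI) (auto simp: mat_delete_def)
    ultimately show "?A $$ (i, j) * cofactor ?A i j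
        = g i j * cofactor (mat r r (\<lambda>(k, j). f k j)) i j"
      using assms by (simp add: cofactor_def)
  qed
  finally show ?thesis .
qed

text \<open>Both sums equal the sum of \<open>g i j\<close> times the cofactor of \<open>f\<close>
  at \<open>(i, j)\<close> over all \<open>i\<close> and \<open>j\<close>: expanding along the
  replaced line only meets cofactors of \<open>f\<close>.\<close>

lemma sum_det_replace_columns_eq_rows:
  fixes f g :: "nat \<Rightarrow> nat \<Rightarrow> 'a::comm_ring_1"
  shows "(\<Sum>j<r. det (mat r r (\<lambda>(i, k). if k = j then g i k else f i k))) =
    (\<Sum>i<r. det (mat r r (\<lambda>(k, j). if k = i then g k j else f k j)))"
  by (simp add: det_replace_column det_replace_row, rule sum.swap)

section \<open>Raising and lowering parts in Jacobi-Trudi determinants\<close>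

text \<open>The size \<open>r\<close> is free, so that \<open>a\<close> can be padded with zeros;
  \<open>a\<close> is integer-valued, since lowering a zero part gives \<open>-1\<close>.\<close>

definition jacobi_trudi :: "(int \<Rightarrow> 'a::comm_ring_1) \<Rightarrow> nat \<Rightarrow> (nat \<Rightarrow> int) \<Rightarrow> 'a" where
  "jacobi_trudi h r a = det (mat r r (\<lambda>(i, j). h (a j + int i - int j)))"

lemma det_last_column_unit:
  fixes f :: "nat \<Rightarrow> nat \<Rightarrow> 'a::comm_ring_1"
  assumes "\<And>i. i < r \<Longrightarrow> f i r = 0"
  shows "det (mat (Suc r) (Suc r) (\<lambda>(i, j). f i j)) = f r r * det (mat r r (\<lambda>(i, j). f i j))"
proof -
  let ?A = "mat (Suc r) (Suc r) (\<lambda>(i, j). f i j)"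
  have "mat_delete ?A r r = mat r r (\<lambda>(i, j). f i j)"
    by (intro eq_matI) (auto simp: mat_delete_def)
  then have "cofactor ?A r r = det (mat r r (\<lambda>(i, j). f i j))"
    by (simp add: cofactor_def)
  moreover have "det ?A = (\<Sum>i<Suc r. ?A $$ (i, r) * cofactor ?A i r)"
    by (rule laplace_expansion_column) auto
  ultimately show ?thesis
    using assms by simp
qed

text \<open>A zero last part makes the last column zero above the diagonal, with
  \<open>h 0 = 1\<close> on it.\<close>

lemma jacobi_trudi_Suc:
  assumes "\<And>m. m < 0 \<Longrightarrow> h m = 0" and "h 0 = 1" and "a r = 0"
  shows "jacobi_trudi h (Suc r) a = jacobi_trudi h r a"
  unfolding jacobi_trudi_def using assms by (subst det_last_column_unit) auto

text \<open>Padding with zero parts lets one determinant size serve all partitions of a given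
  number.\<close>

lemma jacobi_trudi_stable:
  assumes "\<And>m. m < 0 \<Longrightarrow> h m = 0" and "h 0 = 1"
    and "\<And>j. k \<le> j \<Longrightarrow> j < r \<Longrightarrow> a j = 0" and "k \<le> r"
  shows "jacobi_trudi h r a = jacobi_trudi h k a"
  using assms(4,3)
proof (induction r rule: dec_induct)
  case (step r)
  then show ?case using jacobi_trudi_Suc[of h a r] assms(1,2) by simp
qed simp

text \<open>Columns \<open>j\<close> and \<open>Suc j\<close> coincide. This discards the terms in
  which raising or lowering one part does not give a partition.\<close>

lemma jacobi_trudi_eq_0:
  assumes "Suc j < r" and "a (Suc j) = a j + 1"
  shows "jacobi_trudi h r a = 0"
  unfolding jacobi_trudi_def
  by (rule det_identical_columns[of _ r j "Suc j"]) (use assms in \<open>auto intro!: eq_vecI simp: algebra_simps\<close>)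

text \<open>Raising \<open>a j\<close> shifts column \<open>j\<close> by one row. The size exceeds
  \<open>r\<close> by one so that a new row of the diagram can be started.\<close>

lemma jacobi_trudi_pieri:
  assumes neg: "\<And>m. m < 0 \<Longrightarrow> h m = 0" and h0: "h 0 = 1" and a: "a r = 0"
  shows "(\<Sum>j<Suc r. jacobi_trudi h (Suc r) (a(j := a j + 1))) = h 1 * jacobi_trudi h r a"
proof -
  let ?f = "\<lambda>i j. h (a j + int i - int j)" and ?g = "\<lambda>i j. h (a j + int (Suc i) - int j)"
  have "(\<Sum>j<Suc r. jacobi_trudi h (Suc r) (a(j := a j + 1))) =
      (\<Sum>j<Suc r. det (mat (Suc r) (Suc r) (\<lambda>(i, k). if k = j then ?g i k else ?f i k)))"
    unfolding jacobi_trudi_def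
    by (intro sum.cong refl arg_cong[of _ _ det] cong_mat) (auto simp: algebra_simps)
  also have "\<dots> = (\<Sum>i<Suc r. det (mat (Suc r) (Suc r) (\<lambda>(k, j). if k = i then ?g k j else ?f k j)))"
    by (rule sum_det_replace_columns_eq_rows)
  also have "\<dots> = det (mat (Suc r) (Suc r) (\<lambda>(k, j). if k = r then ?g k j else ?f k j))"
  proof -
    \<comment> \<open>Row \<open>i\<close> has become a copy of row \<open>i + 1\<close>.\<close>
    have "det (mat (Suc r) (Suc r) (\<lambda>(k, j). if k = i then ?g k j else ?f k j)) = 0" if "i < r" for i
      by (rule det_identical_rows[of _ "Suc r" i "Suc i"]) (use that in \<open>auto intro!: eq_vecI\<close>)
    then show ?thesis by simp
  qed
  \<comment> \<open>As \<open>a r = 0\<close>, the last column is zero above its bottom entry, which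
    the shift turns from \<open>h 0\<close> into \<open>h 1\<close>.\<close>
  also have "\<dots> = h 1 * jacobi_trudi h r a"
    unfolding jacobi_trudi_def
    by (subst det_last_column_unit)
      (use assms in \<open>auto intro!: arg_cong2[of _ _ _ _ "(*)"] arg_cong[of _ _ det] cong_mat\<close>)
  finally show ?thesis .
qed

text \<open>By \<open>rec\<close>, lowering \<open>a j\<close> multiplies each entry of column
  \<open>j\<close> by its index, a column weight \<open>a j - j\<close> plus a row weight
  \<open>i\<close>. Summing the determinants with one column or one row scaled gives the total
  weight times the determinant.\<close>

lemma jacobi_trudi_lower:
  assumes rec: "\<And>m. of_int m * h m = h (m - 1)"
  shows "(\<Sum>j<r. jacobi_trudi h r (a(j := a j - 1))) = of_int (\<Sum>j<r. a j) * jacobi_trudi h r a"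
proof -
  let ?f = "\<lambda>i j. h (a j + int i - int j)" and ?g = "\<lambda>i j. h (a j + int i - int j - 1)"
  let ?A = "mat r r (\<lambda>(i, j). ?f i j)"
  have g: "?g i j = of_int (a j - int j) * ?f i j + of_nat i * ?f i j" for i j
    unfolding rec[symmetric] by (simp add: algebra_simps)
  have col: "(\<Sum>i<r. ?f i j * cofactor ?A i j) = det ?A" if "j < r" for j
    using that by (subst laplace_expansion_column[of ?A r j]) auto
  have row: "(\<Sum>j<r. ?f i j * cofactor ?A i j) = det ?A" if "i < r" for i
    using that by (subst laplace_expansion_row[of ?A r i]) auto
  have "(\<Sum>j<r. jacobi_trudi h r (a(j := a j - 1))) =
      (\<Sum>j<r. det (mat r r (\<lambda>(i, k). if k = j then ?g i k else ?f i k)))"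
    unfolding jacobi_trudi_def
    by (intro sum.cong refl arg_cong[of _ _ det] cong_mat) (auto simp: algebra_simps)
  also have "\<dots> = (\<Sum>j<r. \<Sum>i<r. ?g i j * cofactor ?A i j)"
    by (simp add: det_replace_column)
  also have "\<dots> = (\<Sum>j<r. of_int (a j - int j) * (\<Sum>i<r. ?f i j * cofactor ?A i j)) +
      (\<Sum>j<r. \<Sum>i<r. of_nat i * (?f i j * cofactor ?A i j))"
    unfolding g by (simp only: sum_distrib_left distrib_right sum.distrib mult.assoc)
  also have "(\<Sum>j<r. \<Sum>i<r. of_nat i * (?f i j * cofactor ?A i j)) =
      (\<Sum>i<r. of_nat i * (\<Sum>j<r. ?f i j * cofactor ?A i j))"
    by (subst sum.swap) (simp only: sum_distrib_left)
  also have "(\<Sum>j<r. of_int (a j - int j) * (\<Sum>i<r. ?f i j * cofactor ?A i j)) +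
      (\<Sum>i<r. of_nat i * (\<Sum>j<r. ?f i j * cofactor ?A i j)) =
      (\<Sum>j<r. of_int (a j - int j) * det ?A) + (\<Sum>i<r. of_nat i * det ?A)"
    using col row by (intro arg_cong2[of _ _ _ _ "(+)"] sum.cong) auto
  \<comment> \<open>The column weights \<open>- j\<close> and the row weights \<open>i\<close>
    cancel in total.\<close>
  also have "\<dots> = of_int (\<Sum>j<r. a j) * det ?A"
    by (simp add: sum_distrib_right sum.distrib[symmetric] algebra_simps)
  finally show ?thesis
    by (simp add: jacobi_trudi_def)
qed

section \<open>The Vandermonde determinant in a monic basis\<close>

text \<open>In the step to size \<open>Suc r\<close>, the determinant is a polynomial in its last
  node, with the other nodes as roots and the smaller determinant as coefficient of degree
  \<open>r\<close>. The basis is left general so that falling factorials can be inserted.\<close>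

lemma det_vandermonde_monic:
  fixes p :: "nat \<Rightarrow> 'a::idom poly"
  assumes deg: "\<And>i. i < r \<Longrightarrow> degree (p i) = i" and monic: "\<And>i. i < r \<Longrightarrow> lead_coeff (p i) = 1"
    and inj: "inj_on x {..<r}"
  shows "det (mat r r (\<lambda>(i, j). poly (p i) (x j))) = (\<Prod>j<r. \<Prod>i<j. x j - x i)"
  using assms
proof (induction r)
  case 0
  then show ?case by simp
next
  case (Suc r)
  let ?A = "mat (Suc r) (Suc r) (\<lambda>(i, j). poly (p i) (x j))"
  let ?d = "det (mat r r (\<lambda>(i, j). poly (p i) (x j)))"
  \<comment> \<open>\<open>P\<close> is the determinant with the last node replaced by a
    variable.\<close>
  define P where "P = (\<Sum>i<Suc r. smult (cofactor ?A i r) (p i))"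
  define Q where "Q = (\<Prod>i<r. [:- x i, 1:])"
  have P: "poly P y = det (mat (Suc r) (Suc r) (\<lambda>(i, k). if k = r then poly (p i) y else poly (p i) (x k)))" for y
    unfolding P_def by (subst det_replace_column) (auto simp: poly_sum mult.commute)
  have "poly P (x j) = 0" if "j < r" for j
    unfolding P by (rule det_identical_columns[of _ "Suc r" j r]) (use that in \<open>auto intro!: eq_vecI\<close>)
  moreover have "poly Q (x j) = 0" if "j < r" for j
    unfolding Q_def using that by (auto simp: poly_prod)
  ultimately have roots: "x ` {..<r} \<subseteq> {y. poly (P - smult ?d Q) y = 0}"
    by auto
  have "mat_delete ?A r r = mat r r (\<lambda>(i, j). poly (p i) (x j))"
    by (intro eq_matI) (auto simp: mat_delete_def)
  then have cof: "cofactor ?A r r = ?d"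
    by (simp add: cofactor_def)
  have degP: "degree P \<le> r"
    unfolding P_def using Suc.prems(1) by (intro degree_sum_le) (auto intro: order.trans[OF degree_smult_le])
  have "coeff (p i) r = 0" if "i < r" for i
    using Suc.prems(1)[of i] that by (intro coeff_eq_0) auto
  moreover have "coeff (p r) r = 1"
    using Suc.prems(1,2)[of r] by simp
  ultimately have cP: "coeff P r = ?d"
    unfolding P_def by (simp add: coeff_sum cof)
  have degQ: "degree Q = r"
    unfolding Q_def by (subst degree_prod_eq_sum_degree) auto
  have cQ: "coeff Q r = 1"
    using lead_coeff_prod[of "\<lambda>i. [:- x i, 1:]" "{..<r}"] degQ by (simp add: Q_def)
  \<comment> \<open>The coefficients of degree \<open>r\<close> cancel, so a nonzero difference
    would have degree below \<open>r\<close> but \<open>r\<close> distinct roots.\<close>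
  have "P - smult ?d Q = 0"
  proof (rule ccontr)
    assume nz: "P - smult ?d Q \<noteq> 0"
    have "coeff (P - smult ?d Q) r = 0"
      using cP cQ by simp
    moreover have le: "degree (P - smult ?d Q) \<le> r"
      using degP degQ by (intro degree_diff_le) (auto intro: order.trans[OF degree_smult_le])
    ultimately have "degree (P - smult ?d Q) < r"
      using nz by (metis le_neq_implies_less leading_coeff_0_iff)
    moreover have "card (x ` {..<r}) \<le> degree (P - smult ?d Q)"
      using card_mono[OF poly_roots_finite[OF nz] roots] card_poly_roots_bound[OF nz] by simp
    moreover have "card (x ` {..<r}) = r"
      using Suc.prems(3) by (subst card_image) (auto intro: inj_on_subset)
    ultimately show False by simp
  qed
  then have "poly P (x r) = ?d * (\<Prod>i<r. x r - x i)"
    by (simp add: Q_def poly_prod)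
  moreover have "poly P (x r) = det ?A"
    unfolding P by (intro arg_cong[of _ _ det] cong_mat) auto
  moreover have "?d = (\<Prod>j<r. \<Prod>i<j. x j - x i)"
    using Suc.prems by (intro Suc.IH) (auto intro: inj_on_subset)
  ultimately show ?case by simp
qed

section \<open>Standard tableaux and Young's lattice\<close>

text \<open>Formulated for any relation, which separates the removal of the largest label from the
  geometry of diagrams.\<close>

definition linear_extensions :: "('a \<Rightarrow> 'a \<Rightarrow> bool) \<Rightarrow> 'a set \<Rightarrow> ('a \<Rightarrow> nat) set" where
  "linear_extensions R D = {T \<in> extensional D. bij_betw T D {1..card D} \<and>
     (\<forall>x \<in> D. \<forall>y \<in> D. R x y \<longrightarrow> T x < T y)}"

lemma linear_extensions_bij_betw:
  "T \<in> linear_extensions R D \<Longrightarrow> bij_betw T D {1..card D}"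
  unfolding linear_extensions_def by blast

lemma linear_extensions_less:
  "T \<in> linear_extensions R D \<Longrightarrow> x \<in> D \<Longrightarrow> y \<in> D \<Longrightarrow> R x y \<Longrightarrow> T x < T y"
  unfolding linear_extensions_def by blast

lemma linear_extensions_undefined:
  "T \<in> linear_extensions R D \<Longrightarrow> x \<notin> D \<Longrightarrow> T x = undefined"
  unfolding linear_extensions_def extensional_def by blast

lemma linear_extensionsI:
  assumes "\<And>x. x \<notin> D \<Longrightarrow> T x = undefined" and "bij_betw T D {1..card D}"
    and "\<And>x y. x \<in> D \<Longrightarrow> y \<in> D \<Longrightarrow> R x y \<Longrightarrow> T x < T y"
  shows "T \<in> linear_extensions R D"
  unfolding linear_extensions_def extensional_def using assms by blast

definition maximal_elems :: "('a \<Rightarrow> 'a \<Rightarrow> bool) \<Rightarrow> 'a set \<Rightarrow> 'a set" where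
  "maximal_elems R D = {c \<in> D. \<forall>y \<in> D. \<not> R c y}"

lemma linear_extensions_empty: "linear_extensions R {} = {\<lambda>_. undefined}"
  by (auto simp: linear_extensions_def bij_betw_def)

lemma finite_linear_extensions:
  assumes "finite D"
  shows "finite (linear_extensions R D)"
proof (rule finite_subset)
  show "linear_extensions R D \<subseteq> (\<Pi>\<^sub>E c \<in> D. {1..card D})"
    by (auto simp: linear_extensions_def PiE_def dest: bij_betw_imp_funcset)
  show "finite (\<Pi>\<^sub>E c \<in> D. {1..card D})"
    by (intro finite_PiE assms) simp
qed

text \<open>The largest label \<open>card D\<close> sits on a maximal element \<open>c\<close>;
  deleting it leaves a linear extension of \<open>D - {c}\<close>, and each of these arises exactly
  once.\<close>

lemma card_linear_extensions_rec:
  assumes fin: "finite D" and ne: "D \<noteq> {}"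
  shows "card (linear_extensions R D) =
    (\<Sum>c \<in> maximal_elems R D. card (linear_extensions R (D - {c})))"
proof -
  let ?S = "SIGMA c : maximal_elems R D. linear_extensions R (D - {c})"
  let ?u = "\<lambda>(c, U). U(c := card D)"
  obtain n where n: "card D = Suc n"
    using fin ne by (metis card_eq_0_iff not0_implies_Suc)
  have cardD: "card (D - {c}) = n" if "c \<in> D" for c
    using n fin that by simp
  \<comment> \<open>All labels away from \<open>c\<close> stay below \<open>Suc n\<close>, so the
    position of \<open>Suc n\<close> recovers \<open>c\<close>.\<close>
  have less: "U x < Suc n" if "U \<in> linear_extensions R (D - {c})" "c \<in> D" "x \<in> D" "x \<noteq> c" for U c x
  proof -
    have bij: "bij_betw U (D - {c}) {1..n}"
      using linear_extensions_bij_betw[OF that(1)] cardD[OF that(2)] by simp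
    have "U x \<in> {1..n}"
      using bij_betwE[OF bij] that(3,4) by simp
    then show ?thesis by simp
  qed
  have "bij_betw ?u ?S (linear_extensions R D)"
  proof (rule bij_betw_imageI)
    show "inj_on ?u ?S"
    proof (rule inj_onI, clarify)
      fix c U c' U'
      assume c: "c \<in> maximal_elems R D" and U: "U \<in> linear_extensions R (D - {c})"
        and c': "c' \<in> maximal_elems R D" and U': "U' \<in> linear_extensions R (D - {c'})"
        and eq: "U(c := card D) = U'(c' := card D)"
      have cc: "c = c'"
        using fun_cong[OF eq, of c] less[OF U', of c] c c' n
        by (auto simp: maximal_elems_def split: if_splits)
      have "U x = U' x" for x
        using fun_cong[OF eq, of x] linear_extensions_undefined[OF U, of x]
          linear_extensions_undefined[OF U', of x] cc
        by (cases "x = c") auto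
      with cc show "c = c' \<and> U = U'" by auto
    qed
    show "?u ` ?S = linear_extensions R D"
    proof (intro equalityI subsetI)
      fix T assume "T \<in> ?u ` ?S"
      then obtain c U where c: "c \<in> maximal_elems R D"
        and U: "U \<in> linear_extensions R (D - {c})" and T: "T = U(c := Suc n)"
        using n by auto
      have cD: "c \<in> D" using c by (simp add: maximal_elems_def)
      have "bij_betw U (D - {c}) {1..n}"
        using linear_extensions_bij_betw[OF U] cardD[OF cD] by simp
      moreover have "bij_betw T (D - {c}) {1..n} = bij_betw U (D - {c}) {1..n}"
        by (rule bij_betw_cong) (simp add: T)
      ultimately have "bij_betw T (D - {c}) {1..n}"
        by simp
      then have "bij_betw T ((D - {c}) \<union> {c}) ({1..n} \<union> {Suc n})"
        by (rule bij_betw_combine) (auto simp: T)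
      moreover have "(D - {c}) \<union> {c} = D" "{1..n} \<union> {Suc n} = {1..Suc n}"
        using cD by auto
      ultimately have "bij_betw T D {1..card D}"
        using n by simp
      moreover have "T x < T y" if "x \<in> D" "y \<in> D" "R x y" for x y
      proof -
        have "x \<noteq> c"
          using c that by (auto simp: maximal_elems_def)
        then show ?thesis
          using that less[OF U cD, of x] linear_extensions_less[OF U, of x y] by (auto simp: T)
      qed
      moreover have "T x = undefined" if "x \<notin> D" for x
        using linear_extensions_undefined[OF U, of x] that cD by (auto simp: T)
      ultimately show "T \<in> linear_extensions R D"
        by (intro linear_extensionsI) auto
    next
      fix T assume T: "T \<in> linear_extensions R D"
      have bij: "bij_betw T D {1..Suc n}"
        using n linear_extensions_bij_betw[OF T] by simp
      then have "Suc n \<in> T ` D"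
        by (simp add: bij_betw_def)
      then obtain c where c: "c \<in> D" "T c = Suc n"
        by auto
      have "T y \<le> Suc n" if "y \<in> D" for y
        using bij_betwE[OF bij] that by auto
      then have "c \<in> maximal_elems R D"
        unfolding maximal_elems_def using linear_extensions_less[OF T, of c] c by fastforce
      moreover have "T(c := undefined) \<in> linear_extensions R (D - {c})"
      proof -
        have "bij_betw T (D - {c}) ({1..Suc n} - {Suc n})"
          using bij c by (intro bij_betw_DiffI) (auto simp: bij_betw_def)
        moreover have "{1..Suc n} - {Suc n} = {1..n}" by auto
        ultimately have "bij_betw T (D - {c}) {1..n}" by simp
        moreover have "bij_betw (T(c := undefined)) (D - {c}) {1..n} = bij_betw T (D - {c}) {1..n}"
          by (rule bij_betw_cong) simp
        ultimately show ?thesis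
          using cardD[OF c(1)] linear_extensions_undefined[OF T] linear_extensions_less[OF T]
          by (intro linear_extensionsI) auto
      qed
      moreover have "T = (T(c := undefined))(c := card D)"
        using c n by (simp add: fun_upd_idem)
      ultimately show "T \<in> ?u ` ?S"
        by (intro image_eqI[of _ _ "(c, T(c := undefined))"]) auto
    qed
  qed
  then have "card (linear_extensions R D) = card ?S"
    by (simp add: bij_betw_same_card)
  also have "\<dots> = (\<Sum>c \<in> maximal_elems R D. card (linear_extensions R (D - {c})))"
    using fin by (intro card_SigmaI) (auto simp: maximal_elems_def intro: finite_linear_extensions)
  finally show ?thesis .
qed

section \<open>Partitions as functions and their diagrams\<close>

text \<open>With a zero tail instead of a length, adding or removing a cell is a function update
  even when the number of nonzero parts changes.\<close>

definition shapes :: "nat \<Rightarrow> (nat \<Rightarrow> nat) set" where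
  "shapes n = {a. antimono a \<and> (\<exists>m. (\<forall>j\<ge>m. a j = 0) \<and> (\<Sum>j<m. a j) = n)}"

lemma shapesI:
  "antimono a \<Longrightarrow> (\<And>j. m \<le> j \<Longrightarrow> a j = 0) \<Longrightarrow> (\<Sum>j<m. a j) = n \<Longrightarrow> a \<in> shapes n"
  by (auto simp: shapes_def)

lemma shapes_antimono: "a \<in> shapes n \<Longrightarrow> i \<le> j \<Longrightarrow> a j \<le> a i"
  by (auto simp: shapes_def antimono_def)

text \<open>If \<open>a j\<close> were positive, the \<open>j + 1\<close> parts up to index
  \<open>j\<close> would sum to more than \<open>n\<close>.\<close>

lemma shapes_eq_0:
  assumes "a \<in> shapes n" "n \<le> j"
  shows "a j = 0"
proof (rule ccontr)
  assume nz: "a j \<noteq> 0"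
  obtain m where m: "\<And>j. m \<le> j \<Longrightarrow> a j = 0" "(\<Sum>j<m. a j) = n"
    using assms by (auto simp: shapes_def)
  have "j < m" using nz m(1) by (meson not_le_imp_less)
  have "Suc j = (\<Sum>i<Suc j. 1)" by simp
  also have "\<dots> \<le> (\<Sum>i<Suc j. a i)"
    using nz shapes_antimono[OF assms(1)] by (intro sum_mono) (metis One_nat_def Suc_leI lessThan_iff less_Suc_eq_le neq0_conv order_less_le_trans)
  also have "\<dots> \<le> (\<Sum>i<m. a i)"
    using \<open>j < m\<close> by (intro sum_mono2) auto
  finally show False using m assms by simp
qed

lemma shapes_sum:
  assumes "a \<in> shapes n"
  shows "(\<Sum>j<n. a j) = n"
proof -
  obtain m where m: "\<And>j. m \<le> j \<Longrightarrow> a j = 0" "(\<Sum>j<m. a j) = n"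
    using assms by (auto simp: shapes_def)
  have "(\<Sum>j<n. a j) = (\<Sum>j<max m n. a j)"
    using shapes_eq_0[OF assms] by (intro sum.mono_neutral_left) auto
  also have "\<dots> = (\<Sum>j<m. a j)"
    using m(1) by (intro sum.mono_neutral_right) auto
  finally show ?thesis using m by simp
qed

lemma shapes_0: "shapes 0 = {\<lambda>_. 0}"
  using shapes_eq_0[of _ 0] by (auto intro!: shapesI[of _ 0] simp: antimono_def)

text \<open>Only cells of a common row or column are compared, so that linear extensions are
  literally standard tableaux.\<close>

definition cell_less :: "nat \<times> nat \<Rightarrow> nat \<times> nat \<Rightarrow> bool" where
  "cell_less = (\<lambda>(i, j) (i', j'). i = i' \<and> j < j' \<or> j = j' \<and> i < i')"

definition cells :: "(nat \<Rightarrow> nat) \<Rightarrow> (nat \<times> nat) set" where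
  "cells a = {(i, j). j < a i}"

definition num_tableaux :: "(nat \<Rightarrow> nat) \<Rightarrow> nat" where
  "num_tableaux a = card (linear_extensions cell_less (cells a))"

lemma cells_shape:
  assumes "a \<in> shapes n"
  shows "cells a = (SIGMA i : {..<n}. {..<a i})"
proof -
  have "i < n" if "j < a i" for i j
    using shapes_eq_0[OF assms, of i] that by (cases "i < n") auto
  then show ?thesis by (auto simp: cells_def)
qed

lemma finite_cells: "a \<in> shapes n \<Longrightarrow> finite (cells a)"
  by (simp add: cells_shape)

lemma card_cells: "a \<in> shapes n \<Longrightarrow> card (cells a) = n"
  by (simp add: cells_shape shapes_sum)

definition removable :: "(nat \<Rightarrow> nat) \<Rightarrow> nat set" where
  "removable a = {j. a (Suc j) < a j}"

text \<open>The case \<open>j = 0\<close> is separate because \<open>j - 1\<close> would be 0 again,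
  while the first row can always be extended.\<close>

definition addable :: "(nat \<Rightarrow> nat) \<Rightarrow> nat set" where
  "addable a = {j. j = 0 \<or> a j < a (j - 1)}"

lemma removable_less:
  assumes "a \<in> shapes n" "j \<in> removable a"
  shows "j < n"
  using shapes_eq_0[OF assms(1), of j] assms(2) by (cases "j < n") (auto simp: removable_def)

text \<open>The maximal cells are the corners: such a cell ends its row, and the next row does not
  reach its column.\<close>

lemma maximal_elems_cells:
  assumes "a \<in> shapes n"
  shows "maximal_elems cell_less (cells a) = (\<lambda>j. (j, a j - 1)) ` removable a"
proof (intro equalityI subsetI)
  fix c assume "c \<in> maximal_elems cell_less (cells a)"
  then obtain i j where c: "c = (i, j)" "j < a i" and max: "\<And>y. y \<in> cells a \<Longrightarrow> \<not> cell_less (i, j) y"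
    by (cases c) (auto simp: maximal_elems_def cells_def)
  have "\<not> Suc j < a i"
    using max[of "(i, Suc j)"] by (auto simp: cells_def cell_less_def)
  moreover have "\<not> j < a (Suc i)"
    using max[of "(Suc i, j)"] by (auto simp: cells_def cell_less_def)
  ultimately show "c \<in> (\<lambda>j. (j, a j - 1)) ` removable a"
    using c by (auto simp: removable_def intro!: image_eqI[of _ _ i])
next
  fix c assume "c \<in> (\<lambda>j. (j, a j - 1)) ` removable a"
  then obtain i where c: "c = (i, a i - 1)" "a (Suc i) < a i"
    by (auto simp: removable_def)
  have "a i' \<le> a (Suc i)" if "i < i'" for i'
    using shapes_antimono[OF assms, of "Suc i" i'] that by simp
  then have "a i' \<le> a i - 1" if "i < i'" for i'
    using c(2) that by fastforce
  then show "c \<in> maximal_elems cell_less (cells a)"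
    using c by (fastforce simp: maximal_elems_def cells_def cell_less_def)
qed

lemma cells_remove:
  assumes "j \<in> removable a"
  shows "cells a - {(j, a j - 1)} = cells (a(j := a j - 1))"
  using assms by (auto simp: cells_def removable_def split: if_splits)

text \<open>Branching rule: the largest entry of a standard tableau occupies a corner.\<close>

lemma num_tableaux_rec:
  assumes "a \<in> shapes (Suc n)"
  shows "num_tableaux a = (\<Sum>j \<in> removable a. num_tableaux (a(j := a j - 1)))"
proof -
  have "cells a \<noteq> {}"
    using card_cells[OF assms] by auto
  then have "num_tableaux a =
      (\<Sum>j \<in> removable a. card (linear_extensions cell_less (cells a - {(j, a j - 1)})))"
    unfolding num_tableaux_def card_linear_extensions_rec[OF finite_cells[OF assms] \<open>cells a \<noteq> {}\<close>]
      maximal_elems_cells[OF assms]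
    by (subst sum.reindex) (auto simp: inj_on_def)
  then show ?thesis
    by (simp add: cells_remove num_tableaux_def del: One_nat_def)
qed

lemma shapes_remove:
  assumes a: "a \<in> shapes (Suc n)" and j: "j \<in> removable a"
  shows "a(j := a j - 1) \<in> shapes n"
proof (rule shapesI[of _ "Suc n"])
  have aj: "a (Suc j) < a j" using j by (simp add: removable_def)
  have "a i \<le> a j - 1" if "j < i" for i
    using shapes_antimono[OF a, of "Suc j" i] that aj by simp
  then show "antimono (a(j := a j - 1))"
    using shapes_antimono[OF a] by (fastforce simp: antimono_def intro: diff_le_self[THEN order.trans])
  show "(a(j := a j - 1)) i = 0" if "Suc n \<le> i" for i
    using shapes_eq_0[OF a that] removable_less[OF a j] that by simp
  have "(\<Sum>i<Suc n. a i) = a j + (\<Sum>i\<in>{..<Suc n} - {j}. a i)"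
    using removable_less[OF a j] by (intro sum.remove) auto
  moreover have "(\<Sum>i<Suc n. (a(j := a j - 1)) i) =
      (a j - 1) + (\<Sum>i\<in>{..<Suc n} - {j}. (a(j := a j - 1)) i)"
    using removable_less[OF a j] by (subst sum.remove[of _ j]) auto
  moreover have "(\<Sum>i\<in>{..<Suc n} - {j}. (a(j := a j - 1)) i) = (\<Sum>i\<in>{..<Suc n} - {j}. a i)"
    by (intro sum.cong) auto
  ultimately show "(\<Sum>i<Suc n. (a(j := a j - 1)) i) = n"
    using shapes_sum[OF a] aj by linarith
qed

lemma shapes_add:
  assumes a: "a \<in> shapes n" and j: "j \<in> addable a" "j < Suc n"
  shows "a(j := Suc (a j)) \<in> shapes (Suc n)"
proof (rule shapesI[of _ "Suc n"])
  have "Suc (a j) \<le> a i" if "i < j" for i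
  proof -
    have "i \<le> j - 1" using that by simp
    then show ?thesis
      using shapes_antimono[OF a, of i "j - 1"] that j by (auto simp: addable_def)
  qed
  moreover have "a i \<le> Suc (a j)" if "j \<le> i" for i
    using shapes_antimono[OF a, of j i] that by simp
  ultimately show "antimono (a(j := Suc (a j)))"
    using shapes_antimono[OF a] by (fastforce simp: antimono_def)
  show "(a(j := Suc (a j))) i = 0" if "Suc n \<le> i" for i
    using shapes_eq_0[OF a, of i] that j by simp
  have "(\<Sum>i<Suc n. a i) = a j + (\<Sum>i\<in>{..<Suc n} - {j}. a i)"
    using j by (intro sum.remove) auto
  moreover have "(\<Sum>i<Suc n. (a(j := Suc (a j))) i) =
      Suc (a j) + (\<Sum>i\<in>{..<Suc n} - {j}. (a(j := Suc (a j))) i)"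
    using j by (subst sum.remove[of _ j]) auto
  moreover have "(\<Sum>i\<in>{..<Suc n} - {j}. (a(j := Suc (a j))) i) = (\<Sum>i\<in>{..<Suc n} - {j}. a i)"
    by (intro sum.cong) auto
  moreover have "(\<Sum>i<Suc n. a i) = n"
    using shapes_sum[OF a] shapes_eq_0[OF a, of n] by simp
  ultimately show "(\<Sum>i<Suc n. (a(j := Suc (a j))) i) = Suc n"
    by linarith
qed

lemma addable_remove: "j \<in> removable a \<Longrightarrow> a \<in> shapes n \<Longrightarrow> j \<in> addable (a(j := a j - 1))"
  using shapes_antimono[of a n "j - 1" j] by (auto simp: addable_def removable_def)

lemma removable_add: "a \<in> shapes n \<Longrightarrow> j \<in> removable (a(j := Suc (a j)))"
  using shapes_antimono[of a n j "Suc j"] by (auto simp: removable_def)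

section \<open>Back to lists, and double counting in Young's lattice\<close>

text \<open>Parts are positive, so the first zero of the padded function marks the length of the
  list.\<close>

lemma bij_betw_shapes: "bij_betw (nth_default 0) (partitions n) (shapes n)"
proof (rule bij_betw_imageI)
  show "inj_on (nth_default (0::nat)) (partitions n)"
  proof (rule inj_onI)
    fix l l' :: "nat list"
    assume l: "l \<in> partitions n" "l' \<in> partitions n" and eq: "nth_default 0 l = nth_default 0 l'"
    have len: "length x \<le> length y"
      if "\<forall>k \<in> set x. 0 < k" "nth_default 0 x = nth_default 0 y" for x y :: "nat list"
    proof (rule ccontr)
      assume "\<not> length x \<le> length y"
      then have "nth_default 0 y (length y) = 0" "nth_default 0 x (length y) > 0"
        using that(1) by (auto simp: nth_default_def)
      with that(2) show False by simp
    qed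
    have "length l = length l'"
      using len[of l l'] len[of l' l] l eq by (auto simp: partitions_def)
    then show "l = l'"
      using eq by (intro nth_equalityI) (auto simp: nth_default_def fun_eq_iff split: if_splits)
  qed
  show "nth_default 0 ` partitions n = shapes n"
  proof (intro equalityI subsetI)
    fix a assume "a \<in> nth_default 0 ` partitions n"
    then obtain l where l: "l \<in> partitions n" and a: "a = nth_default 0 l" by auto
    show "a \<in> shapes n"
    proof (rule shapesI[of _ "length l"])
      have "l ! j \<le> l ! i" if "i \<le> j" "j < length l" for i j
        using l that by (cases "i = j") (auto simp: partitions_def sorted_wrt_iff_nth_less)
      then show "antimono a"
        by (auto simp: a antimono_def nth_default_def)
      show "a j = 0" if "length l \<le> j" for j
        using that by (simp add: a nth_default_def)
      have "(\<Sum>j<length l. a j) = sum_list l"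
        by (simp add: a sum_list_sum_nth atLeast0LessThan nth_default_def)
      then show "(\<Sum>j<length l. a j) = n"
        using l by (simp add: partitions_def)
    qed
  next
    fix a assume a: "a \<in> shapes n"
    define m where "m = (LEAST m. a m = 0)"
    have "a m = 0"
      unfolding m_def by (rule LeastI[of _ n]) (rule shapes_eq_0[OF a order.refl])
    have pos: "a j > 0" if "j < m" for j
      using not_less_Least[of j "\<lambda>m. a m = 0"] that by (simp add: m_def)
    have zero: "a j = 0" if "m \<le> j" for j
      using shapes_antimono[OF a that] \<open>a m = 0\<close> by simp
    have "m \<le> n"
      unfolding m_def by (rule Least_le) (rule shapes_eq_0[OF a order.refl])
    have "(\<Sum>j<m. a j) = (\<Sum>j<n. a j)"
      using \<open>m \<le> n\<close> zero by (intro sum.mono_neutral_left) auto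
    then have "sum_list (map a [0..<m]) = n"
      using shapes_sum[OF a] by (simp add: interv_sum_list_conv_sum_set_nat atLeast0LessThan)
    moreover have "sorted_wrt (\<ge>) (map a [0..<m])"
      using shapes_antimono[OF a] by (auto simp: sorted_wrt_iff_nth_less)
    ultimately have "map a [0..<m] \<in> partitions n"
      using pos by (auto simp: partitions_def)
    moreover have "a = nth_default 0 (map a [0..<m])"
      using zero by (auto simp: fun_eq_iff nth_default_def)
    ultimately show "a \<in> nth_default 0 ` partitions n" by blast
  qed
qed

lemma finite_shapes: "finite (shapes n)"
  using bij_betw_finite[OF bij_betw_shapes] finite_partitions by blast

text \<open>The two sets of functions are equal: \<open>sum_list l\<close> is the number of cells,
  and \<open>cell_less\<close> joins the row and column conditions.\<close>

lemma num_SYT_eq_num_tableaux: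
  assumes "l \<in> partitions n"
  shows "num_SYT l = num_tableaux (nth_default 0 l)"
proof -
  have shape: "nth_default 0 l \<in> shapes n"
    using bij_betwE[OF bij_betw_shapes] assms by blast
  have cells: "young_diagram l = cells (nth_default 0 l)"
    by (auto simp: young_diagram_def cells_def nth_default_def split: if_splits)
  have "sum_list l = card (cells (nth_default 0 l))"
    using card_cells[OF shape] assms by (simp add: partitions_def)
  then have "standard_tableaux l = linear_extensions cell_less (cells (nth_default 0 l))"
    unfolding standard_tableaux_def linear_extensions_def cells
    by (intro Collect_cong) (fastforce simp: cell_less_def)
  then show ?thesis
    by (simp add: num_SYT_def num_tableaux_def)
qed

text \<open>Both sides sum over the pairs of shapes that differ by one cell, in row
  \<open>j\<close>; one fixes the larger shape first, the other the smaller.\<close>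

lemma sum_shapes_exchange:
  "(\<Sum>a \<in> shapes (Suc n). \<Sum>j \<in> removable a. g (a(j := a j - 1)) a) =
   (\<Sum>b \<in> shapes n. \<Sum>j \<in> addable b \<inter> {..<Suc n}. g b (b(j := Suc (b j))))"
proof -
  have fin: "finite (removable a)" if "a \<in> shapes (Suc n)" for a
    by (rule finite_subset[of _ "{..<Suc n}"]) (use removable_less[OF that] in auto)
  have "(\<Sum>a \<in> shapes (Suc n). \<Sum>j \<in> removable a. g (a(j := a j - 1)) a) =
      (\<Sum>(a, j) \<in> (SIGMA a : shapes (Suc n). removable a). g (a(j := a j - 1)) a)"
    using fin by (intro sum.Sigma) (auto simp: finite_shapes)
  also have "\<dots> = (\<Sum>(b, j) \<in> (SIGMA b : shapes n. addable b \<inter> {..<Suc n}). g b (b(j := Suc (b j))))"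
  proof (rule sum.reindex_bij_witness[where i = "\<lambda>(b, j). (b(j := Suc (b j)), j)"
        and j = "\<lambda>(a, j). (a(j := a j - 1), j)"], goal_cases)
    case (1 p)
    then show ?case by (auto simp: removable_def)
  next
    case (2 p)
    then show ?case
      by (auto simp: shapes_remove addable_remove removable_less simp del: One_nat_def)
  next
    case (3 p)
    then show ?case by auto
  next
    case (4 p)
    then show ?case
      by (auto simp: removable_add simp del: fun_upd_apply intro: shapes_add)
  next
    case (5 p)
    then show ?case by (auto simp: removable_def)
  qed
  also have "\<dots> = (\<Sum>b \<in> shapes n. \<Sum>j \<in> addable b \<inter> {..<Suc n}. g b (b(j := Suc (b j))))"
    by (intro sum.Sigma[symmetric]) (auto simp: finite_shapes)
  finally show ?thesis .
qed

section \<open>Wronskian Hermite polynomials\<close>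

abbreviation shape_jt :: "(int \<Rightarrow> 'a::comm_ring_1) \<Rightarrow> nat \<Rightarrow> (nat \<Rightarrow> nat) \<Rightarrow> 'a" where
  "shape_jt h r a \<equiv> jacobi_trudi h r (\<lambda>j. int (a j))"

lemma num_tableaux_0: "num_tableaux (\<lambda>_. 0) = 1"
  by (simp add: num_tableaux_def cells_def linear_extensions_empty)

lemma jacobi_trudi_0: "jacobi_trudi h 0 a = 1"
  by (simp add: jacobi_trudi_def)

text \<open>Branching expands the tableau count of each \<open>a\<close>, the exchange collects the
  shapes above each \<open>b\<close>, and the Pieri rule sums their determinants to
  \<open>h 1\<close> times that of \<open>b\<close>.\<close>

lemma sum_num_tableaux_jacobi_trudi:
  assumes neg: "\<And>m. m < 0 \<Longrightarrow> h m = 0" and h0: "h 0 = 1"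
  shows "(\<Sum>a \<in> shapes n. of_nat (num_tableaux a) * shape_jt h n a) = h 1 ^ n"
proof (induction n)
  case 0
  then show ?case by (simp add: shapes_0 num_tableaux_0 jacobi_trudi_0)
next
  case (Suc n)
  have pieri: "(\<Sum>j \<in> addable b \<inter> {..<Suc n}. shape_jt h (Suc n) (b(j := Suc (b j)))) =
      h 1 * shape_jt h n b" if b: "b \<in> shapes n" for b
  proof -
    let ?b = "\<lambda>j. int (b j)"
    have upd: "(\<lambda>k. int ((b(j := Suc (b j))) k)) = ?b(j := ?b j + 1)" for j
      by auto
    \<comment> \<open>If row \<open>j\<close> cannot be extended, it is as long as the row above,
      and raising it makes two adjacent columns equal.\<close>
    have "jacobi_trudi h (Suc n) (?b(j := ?b j + 1)) = 0" if j: "j < Suc n" "j \<notin> addable b" for j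
    proof -
      obtain i where i: "j = Suc i" "b (Suc i) = b i"
        using j(2) shapes_antimono[OF b, of "j - 1" j] by (cases j) (auto simp: addable_def)
      then show ?thesis
        using j(1) by (intro jacobi_trudi_eq_0[of i]) auto
    qed
    then have "(\<Sum>j \<in> addable b \<inter> {..<Suc n}. jacobi_trudi h (Suc n) (?b(j := ?b j + 1))) =
        (\<Sum>j<Suc n. jacobi_trudi h (Suc n) (?b(j := ?b j + 1)))"
      by (intro sum.mono_neutral_left) auto
    also have "\<dots> = h 1 * shape_jt h n b"
      using shapes_eq_0[OF b] by (intro jacobi_trudi_pieri neg h0) auto
    finally show ?thesis
      unfolding upd .
  qed
  have "(\<Sum>a \<in> shapes (Suc n). of_nat (num_tableaux a) * shape_jt h (Suc n) a) =
      (\<Sum>a \<in> shapes (Suc n). \<Sum>j \<in> removable a.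
        of_nat (num_tableaux (a(j := a j - 1))) * shape_jt h (Suc n) a)"
    by (simp add: num_tableaux_rec sum_distrib_right)
  also have "\<dots> = (\<Sum>b \<in> shapes n. \<Sum>j \<in> addable b \<inter> {..<Suc n}.
      of_nat (num_tableaux b) * shape_jt h (Suc n) (b(j := Suc (b j))))"
    by (rule sum_shapes_exchange[where g = "\<lambda>b a. of_nat (num_tableaux b) * shape_jt h (Suc n) a"])
  also have "\<dots> = (\<Sum>b \<in> shapes n. of_nat (num_tableaux b) * (h 1 * shape_jt h n b))"
    unfolding sum_distrib_left[symmetric] using pieri by (intro sum.cong) auto
  also have "\<dots> = h 1 * (\<Sum>b \<in> shapes n. of_nat (num_tableaux b) * shape_jt h n b)"
    by (simp only: sum_distrib_left mult.left_commute)
  finally show ?case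
    using Suc.IH by simp
qed

section \<open>Tableau counts as determinants of reciprocal factorials\<close>

definition inv_fact :: "int \<Rightarrow> real" where
  "inv_fact m = (if m < 0 then 0 else 1 / fact (nat m))"

text \<open>At \<open>m = 0\<close> both sides vanish, thanks to the value 0 of
  \<open>inv_fact\<close> at negative arguments.\<close>

lemma inv_fact_rec: "of_int m * inv_fact m = inv_fact (m - 1)"
proof (cases "m > 0")
  case True
  then obtain k where "m = int (Suc k)"
    using pos_int_cases by (metis Suc_pred)
  then show ?thesis
    by (simp add: inv_fact_def nat_add_distrib divide_simps)
qed (auto simp: inv_fact_def)

text \<open>The right-hand side obeys the branching rule too: by \<open>jacobi_trudi_lower\<close>
  the determinants of the lowered shapes add up to \<open>Suc n\<close> times that of
  \<open>a\<close>, which turns \<open>fact n\<close> into \<open>fact (Suc n)\<close>.\<close>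

lemma num_tableaux_eq_jacobi_trudi:
  "a \<in> shapes n \<Longrightarrow> real (num_tableaux a) = fact n * shape_jt inv_fact n a"
proof (induction n arbitrary: a)
  case 0
  then show ?case by (simp add: shapes_0 num_tableaux_0 jacobi_trudi_0)
next
  case (Suc n)
  let ?a = "\<lambda>j. int (a j)"
  have neg: "inv_fact m = 0" if "m < 0" for m using that by (simp add: inv_fact_def)
  have one: "inv_fact 0 = 1" by (simp add: inv_fact_def)
  have IH: "real (num_tableaux (a(j := a j - 1))) =
      fact n * jacobi_trudi inv_fact (Suc n) (?a(j := ?a j - 1))" if j: "j \<in> removable a" for j
  proof -
    have b: "a(j := a j - 1) \<in> shapes n"
      using Suc.prems j by (rule shapes_remove)
    have "(\<lambda>k. int ((a(j := a j - 1)) k)) = ?a(j := ?a j - 1)"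
      using j by (auto simp: removable_def)
    moreover have "shape_jt inv_fact (Suc n) (a(j := a j - 1)) = shape_jt inv_fact n (a(j := a j - 1))"
      using shapes_eq_0[OF b order.refl] by (intro jacobi_trudi_Suc neg one) auto
    ultimately show ?thesis
      using Suc.IH[OF b] by (simp only:)
  qed
  \<comment> \<open>Lowering a part that equals the next one makes their columns equal.\<close>
  have zero: "jacobi_trudi inv_fact (Suc n) (?a(j := ?a j - 1)) = 0"
    if j: "j < Suc n" "j \<notin> removable a" for j
  proof -
    have eq: "a (Suc j) = a j"
      using j(2) shapes_antimono[OF Suc.prems, of j "Suc j"] by (auto simp: removable_def)
    show ?thesis
    proof (cases "j = n")
      \<comment> \<open>There is no next column here; instead the lowered last part is
        \<open>-1\<close>, so the whole last column vanishes.\<close>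
      case True
      then have "a n = 0"
        using eq shapes_eq_0[OF Suc.prems, of "Suc n"] by simp
      then show ?thesis
        unfolding jacobi_trudi_def using True neg by (subst det_last_column_unit) auto
    next
      case False
      then show ?thesis
        using eq j(1) by (intro jacobi_trudi_eq_0[of j]) auto
    qed
  qed
  have "real (num_tableaux a) =
      fact n * (\<Sum>j \<in> removable a. jacobi_trudi inv_fact (Suc n) (?a(j := ?a j - 1)))"
    unfolding num_tableaux_rec[OF Suc.prems] using IH by (simp add: sum_distrib_left)
  also have "(\<Sum>j \<in> removable a. jacobi_trudi inv_fact (Suc n) (?a(j := ?a j - 1))) =
      (\<Sum>j<Suc n. jacobi_trudi inv_fact (Suc n) (?a(j := ?a j - 1)))"
    using zero removable_less[OF Suc.prems] by (intro sum.mono_neutral_left) auto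
  also have "\<dots> = of_int (\<Sum>j<Suc n. ?a j) * shape_jt inv_fact (Suc n) a"
    by (intro jacobi_trudi_lower inv_fact_rec)
  also have "(\<Sum>j<Suc n. ?a j) = int (Suc n)"
    using shapes_sum[OF Suc.prems] by (metis of_nat_sum)
  finally show ?case
    by simp
qed

lemma det_scale_columns:
  fixes f :: "nat \<Rightarrow> nat \<Rightarrow> 'a::comm_ring_1"
  shows "det (mat r r (\<lambda>(i, j). c j * f i j)) = (\<Prod>j<r. c j) * det (mat r r (\<lambda>(i, j). f i j))"
proof -
  have "(\<Prod>j<r. mat r r (\<lambda>(i, j). c j * f i j) $$ (p j, j)) =
      (\<Prod>j<r. c j) * (\<Prod>j<r. mat r r (\<lambda>(i, j). f i j) $$ (p j, j))"
    if "p permutes {0..<r}" for p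
    unfolding prod.distrib[symmetric]
    using permutes_in_image[OF that] by (intro prod.cong) auto
  then show ?thesis
    by (simp add: det_col[of _ r] sum_distrib_left mult.left_commute)
qed

section \<open>Wronskian and Vandermonde product as Jacobi-Trudi determinants\<close>

text \<open>Its sign enters both the Wronskian and the Vandermonde product and cancels in their
  quotient.\<close>

definition rev_perm :: "nat \<Rightarrow> nat \<Rightarrow> nat" where
  "rev_perm r i = (if i < r then r - Suc i else i)"

lemma rev_perm_permutes: "rev_perm r permutes {0..<r}"
  by (rule bij_imp_permutes) (auto simp: rev_perm_def intro!: bij_betwI[where g = "rev_perm r"])

text \<open>Reversing the rows turns indices that fall from row to row, as under differentiation,
  into the rising ones of \<open>jacobi_trudi\<close>.\<close>

lemma det_reversed_jacobi_trudi:
  fixes h :: "int \<Rightarrow> 'a::comm_ring_1"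
  shows "det (mat r r (\<lambda>(i, j). c j * h (a j + int (r - Suc j) - int i))) =
    of_int (sign (rev_perm r)) * (\<Prod>j<r. c j) * jacobi_trudi h r a"
proof -
  have "mat r r (\<lambda>(i, j). h (a j + int (r - Suc j) - int i)) =
      mat r r (\<lambda>(i, j). mat r r (\<lambda>(i, j). h (a j + int i - int j)) $$ (rev_perm r i, j))"
    by (intro eq_matI) (auto simp: rev_perm_def of_nat_diff algebra_simps)
  then have "det (mat r r (\<lambda>(i, j). h (a j + int (r - Suc j) - int i))) =
      of_int (sign (rev_perm r)) * jacobi_trudi h r a"
    unfolding jacobi_trudi_def
    by (simp only: det_permute_rows[OF mat_carrier rev_perm_permutes])
  then show ?thesis
    by (simp add: det_scale_columns)
qed

lemma pderiv_hermite_Suc: "pderiv (hermite (Suc n)) = of_nat (Suc n) * hermite n"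
proof (induction n rule: induct_nat_012)
  case 0
  then show ?case by (simp add: pderiv_pCons)
next
  case 1
  then show ?case by (simp add: pderiv_pCons pderiv_mult pderiv_diff numeral_poly)
next
  case (ge2 n)
  have "pderiv (hermite (Suc (Suc (Suc n)))) = hermite (Suc (Suc n)) +
      [:0, 1:] * (of_nat (Suc (Suc n)) * hermite (Suc n)) - of_nat (Suc (Suc n)) * (of_nat (Suc n) * hermite n)"
    unfolding hermite.simps(3)[of "Suc n"]
    by (simp only: pderiv_mult pderiv_diff pderiv_of_nat ge2) (simp add: pderiv_pCons)
  \<comment> \<open>The last two terms are \<open>n + 2\<close> times the three-term recurrence for
    \<open>hermite (n + 2)\<close>.\<close>
  also have "\<dots> = of_nat (Suc (Suc (Suc n))) * hermite (Suc (Suc n))"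
    by (simp only: hermite.simps(3)) (simp add: algebra_simps)
  finally show ?case .
qed

text \<open>The extension by 0 makes differentiation lower the index for every integer, which covers
  derivatives of order above the degree.\<close>

definition hermite_div_fact :: "int \<Rightarrow> real poly" where
  "hermite_div_fact m = (if m < 0 then 0 else smult (1 / fact (nat m)) (hermite (nat m)))"

lemma pderiv_hermite_div_fact: "pderiv (hermite_div_fact m) = hermite_div_fact (m - 1)"
proof (cases "m > 0")
  case True
  then have m: "nat m = Suc (nat (m - 1))"
    by simp
  show ?thesis
    unfolding hermite_div_fact_def m using True
    by (simp add: pderiv_smult pderiv_hermite_Suc
        of_nat_poly divide_simps del: hermite.simps of_nat_Suc)
next
  case False
  then show ?thesis
    by (cases "m = 0") (auto simp: hermite_div_fact_def)
qed

lemma higher_pderiv_hermite: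
  "(pderiv ^^ i) (hermite n) = [:fact n:] * hermite_div_fact (int n - int i)"
proof (induction i)
  case 0
  then show ?case by (simp add: hermite_div_fact_def)
next
  case (Suc i)
  then show ?case by (simp add: pderiv_smult pderiv_hermite_div_fact algebra_simps)
qed

text \<open>For \<open>i > n\<close> the product contains the factor 0, and \<open>inv_fact\<close>
  has a negative argument.\<close>

lemma falling_factorial_inv_fact: "(\<Prod>k<i. real n - real k) = fact n * inv_fact (int n - int i)"
proof (induction i)
  case 0
  then show ?case by (simp add: inv_fact_def)
next
  case (Suc i)
  have "inv_fact (int n - int (Suc i)) = (real n - real i) * inv_fact (int n - int i)"
    using inv_fact_rec[of "int n - int i"] by (simp add: algebra_simps)
  then show ?case
    using Suc by (simp add: mult_ac)
qed

lemma nth_degree_seq: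
  "j < length l \<Longrightarrow> int (degree_seq l ! j) = int (nth_default 0 l j) + int (length l - Suc j)"
  by (simp add: degree_seq_def nth_default_def)

lemma length_degree_seq: "length (degree_seq l) = length l"
  by (simp add: degree_seq_def)

lemma inj_degree_seq:
  assumes "l \<in> partitions n"
  shows "inj_on (\<lambda>j. real (degree_seq l ! j)) {..<length l}"
proof (rule linorder_inj_onI)
  fix i j assume "i < j" "j \<in> {..<length l}"
  moreover from this have "l ! j \<le> l ! i"
    using assms by (auto simp: partitions_def sorted_wrt_iff_nth_less)
  ultimately show "real (degree_seq l ! i) \<noteq> real (degree_seq l ! j)"
    by (simp add: degree_seq_def)
qed auto

text \<open>In the basis of falling factorials the Vandermonde matrix has entries n_j! / (n_j - i)!,
  a row-reversed and column-scaled Jacobi-Trudi matrix for \<open>inv_fact\<close>.\<close>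

lemma vandermonde_degree_seq:
  assumes "l \<in> partitions n"
  shows "vandermonde (degree_seq l) = of_int (sign (rev_perm (length l))) *
    (\<Prod>j<length l. fact (degree_seq l ! j)) * shape_jt inv_fact (length l) (nth_default 0 l)"
proof -
  let ?r = "length l" and ?d = "\<lambda>j. degree_seq l ! j"
  define p :: "nat \<Rightarrow> real poly" where "p i = (\<Prod>k<i. [:- real k, 1:])" for i
  have "degree (p i) = i" for i
    unfolding p_def by (subst degree_prod_eq_sum_degree) auto
  moreover have "lead_coeff (p i) = 1" for i
    unfolding p_def by (subst lead_coeff_prod) simp
  ultimately have "vandermonde (degree_seq l) = det (mat ?r ?r (\<lambda>(i, j). poly (p i) (real (?d j))))"
    using inj_degree_seq[OF assms]
    by (subst det_vandermonde_monic) (auto simp: vandermonde_def length_degree_seq)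
  also have "\<dots> = det (mat ?r ?r (\<lambda>(i, j). fact (?d j) *
      inv_fact (int (nth_default 0 l j) + int (?r - Suc j) - int i)))"
    by (intro arg_cong[of _ _ det] cong_mat)
      (auto simp: p_def poly_prod falling_factorial_inv_fact nth_degree_seq)
  finally show ?thesis
    using det_reversed_jacobi_trudi[of ?r "\<lambda>j. fact (?d j)" inv_fact "\<lambda>j. int (nth_default 0 l j)"]
    by (rule trans)
qed

text \<open>Derivative \<open>i\<close> of He_m is m! times \<open>hermite_div_fact (m - i)\<close>,
  so the matrix is that of the Vandermonde product with \<open>hermite_div_fact\<close> in place of
  \<open>inv_fact\<close>.\<close>

lemma wronskian_degree_seq:
  "wronskian (map hermite (degree_seq l)) = of_int (sign (rev_perm (length l))) *
    (\<Prod>j<length l. [:fact (degree_seq l ! j):]) * shape_jt hermite_div_fact (length l) (nth_default 0 l)"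
proof -
  let ?r = "length l" and ?d = "\<lambda>j. degree_seq l ! j"
  have "wronskian (map hermite (degree_seq l)) = det (mat ?r ?r (\<lambda>(i, j). [:fact (?d j):] *
      hermite_div_fact (int (nth_default 0 l j) + int (?r - Suc j) - int i)))"
    unfolding wronskian_def length_map length_degree_seq
    by (intro arg_cong[of _ _ det] cong_mat)
      (auto simp: length_degree_seq higher_pderiv_hermite nth_degree_seq)
  then show ?thesis
    using det_reversed_jacobi_trudi[of ?r "\<lambda>j. [:fact (?d j):]" hermite_div_fact
        "\<lambda>j. int (nth_default 0 l j)"]
    by (rule trans)
qed

lemma length_partition_le:
  assumes l: "l \<in> partitions n"
  shows "length l \<le> n"
proof (rule ccontr)
  assume "\<not> length l \<le> n"
  then have "n < length l" by simp
  then have "0 < l ! n"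
    using l nth_mem[of n l] by (simp add: partitions_def)
  moreover have "nth_default 0 l \<in> shapes n"
    using bij_betwE[OF bij_betw_shapes] l by blast
  then have "nth_default 0 l n = 0"
    by (rule shapes_eq_0) simp
  ultimately show False
    using \<open>n < length l\<close> by (simp add: nth_default_def)
qed

text \<open>Sign and factorials cancel between Wronskian and Vandermonde product. What remains of
  the latter is F / n! for F = \<open>num_SYT l\<close>, and F^2 / n! divided by this is F.\<close>

lemma wronskian_hermite_eq_jacobi_trudi:
  assumes l: "l \<in> partitions n"
  shows "smult ((real (num_SYT l))\<^sup>2 / fact n) (wronskian_hermite l) =
    of_nat (num_SYT l) * shape_jt hermite_div_fact n (nth_default 0 l)"
proof (cases "num_SYT l = 0")
  \<comment> \<open>The cancellation divides by F; for F = 0 both sides are 0.\<close>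
  case False
  let ?r = "length l" and ?a = "nth_default 0 l" and ?F = "real (num_SYT l)"
  define s :: real where "s = of_int (sign (rev_perm ?r))"
  define c :: real where "c = (\<Prod>j<?r. fact (degree_seq l ! j))"
  have stable: "shape_jt h n ?a = shape_jt h ?r ?a" if "\<And>m. m < 0 \<Longrightarrow> h m = 0" "h 0 = 1"
    for h :: "int \<Rightarrow> 'b::comm_ring_1"
    using length_partition_le[OF l] by (intro jacobi_trudi_stable that) (auto simp: nth_default_def)
  have "?a \<in> shapes n"
    using bij_betwE[OF bij_betw_shapes] l by blast
  then have "?F = fact n * shape_jt inv_fact ?r ?a"
    using num_tableaux_eq_jacobi_trudi stable[of inv_fact] num_SYT_eq_num_tableaux[OF l]
    by (simp add: inv_fact_def)
  then have V: "vandermonde (degree_seq l) = s * c * (?F / fact n)"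
    unfolding vandermonde_degree_seq[OF l] by (simp add: s_def c_def)
  have "(\<Prod>j<k. [:fact (degree_seq l ! j):]) = [:\<Prod>j<k. fact (degree_seq l ! j) :: real:]" for k
    by (induction k) (simp_all add: one_pCons mult.commute)
  then have "(\<Prod>j<?r. [:fact (degree_seq l ! j):]) = [:c:]"
    by (simp only: c_def)
  moreover have "of_int (sign (rev_perm ?r)) = [:s:]"
    by (simp add: s_def of_int_poly)
  ultimately have W: "wronskian (map hermite (degree_seq l)) = smult (s * c) (shape_jt hermite_div_fact n ?a)"
    unfolding wronskian_degree_seq by (simp add: stable hermite_div_fact_def mult.commute)
  have "s \<noteq> 0" "c \<noteq> 0"
    by (auto simp: s_def c_def sign_def)
  then have "?F\<^sup>2 / fact n * (1 / (s * c * (?F / fact n)) * (s * c)) = ?F"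
    using False by (simp add: field_simps power2_eq_square)
  then show ?thesis
    by (simp add: wronskian_hermite_def V W of_nat_poly)
qed simp

theorem theorem3p4:
  fixes n :: nat
  shows "(\<Sum>l \<in> partitions n. smult ((real (num_SYT l))\<^sup>2 / fact n) (wronskian_hermite l)) = [:0, 1:] ^ n"
proof -
  have "(\<Sum>l \<in> partitions n. smult ((real (num_SYT l))\<^sup>2 / fact n) (wronskian_hermite l)) =
      (\<Sum>l \<in> partitions n. of_nat (num_tableaux (nth_default 0 l)) * shape_jt hermite_div_fact n (nth_default 0 l))"
    by (intro sum.cong refl) (simp only: num_SYT_eq_num_tableaux[symmetric] wronskian_hermite_eq_jacobi_trudi)
  also have "\<dots> = (\<Sum>a \<in> shapes n. of_nat (num_tableaux a) * shape_jt hermite_div_fact n a)"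
    by (rule sum.reindex_bij_betw[OF bij_betw_shapes])
  also have "\<dots> = hermite_div_fact 1 ^ n"
    by (rule sum_num_tableaux_jacobi_trudi) (auto simp: hermite_div_fact_def)
  also have "hermite_div_fact 1 = [:0, 1:]"
    by (simp add: hermite_div_fact_def)
  finally show ?thesis .
qed

end
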